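(* Let $r\ge1$ be an integer and $\lambda,\mu,\kappa>0$; put $\theta=\lambda/\mu$, $\gamma=\kappa/\mu$ and $$\alpha=\frac{r+\theta+\gamma-\sqrt{(r+\theta+\gamma)^2-4\theta r}}{2r}.$$ Let $\pi$ be the stationary distribution of the M/M/$r$ queue with random resetting (see context) and $P_{\mathrm{delay}}=\sum_{n\ge r}\pi_n$. Then the probability $P_{\mathrm{CSBR}}$ that a customer arriving to the stationary system eventually completes service before a resetting occurs is $$P_{\mathrm{CSBR}}=\sum_{n=0}^{r-1}\pi_n\frac{1}{1+\gamma}+\sum_{n=r}^\infty\pi_n\left(\frac{r}{r+\gamma}\right)^{n-r+1}\frac{1}{1+\gamma}$$ $$=\frac{1}{1+\gamma}\left(1-P_{\mathrm{delay}}\right)+\frac{1}{1+\gamma}\,\frac{(1-\alpha)\gamma}{(1-\alpha)r+\gamma}\,P_{\mathrm{delay}}=\frac{1}{1+\gamma}-\frac{(1-\alpha)r+\alpha\gamma}{(1+\gamma)\left((1-\alpha)r+\gamma\right)}\,P_{\mathrm{delay}}.$$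
   Context: The M/M/$r$ queue with random resetting (first-come first-served) is the continuous-time Markov chain on $\mathbb{Z}_+$ with transition mechanisms: $i\to i+1$ at rate $\lambda$ ($i\ge0$, arrival); $i\to i-1$ at rate $\min(i,r)\mu$ ($i\ge1$, departure); $i\to0$ at rate $\kappa$ ($i\ge1$, resetting, clearing all customers). It has a unique stationary distribution $\pi$, which satisfies $\pi_n=\alpha^{n-r+1}\pi_{r-1}$ for $n\ge r$. The arriving customer finds $n$ customers in the system with probability $\pi_n$. If $n\le r-1$ it is served immediately, and completes service before a resetting with probability $\mu/(\mu+\kappa)=1/(1+\gamma)$. If $n\ge r$ it must first wait for the preceding $n-r+1$ service completions, and completes service before a resetting with probability $\left(\frac{r\mu}{r\mu+\kappa}\right)^{n-r+1}\frac{\mu}{\mu+\kappa}=\left(\frac{r}{r+\gamma}\right)^{n-r+1}\frac{1}{1+\gamma}$.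
   Formalization: The printed closed forms fail unless γ = r; here the numerator (1−α)γ in the second expression is corrected to (1−α)r, and (1−α)r+αγ in the last expression to γ. *)

theory Defs
  imports "HOL-Probability.Probability"
begin

text \<open>Continuous-time Markov chains. Rates \<open>q\<close> are off-diagonal: \<open>q i i\<close> is never used.\<close>

definition transition_function :: "('s \<Rightarrow> 's \<Rightarrow> real) \<Rightarrow> (real \<Rightarrow> 's \<Rightarrow> 's pmf) \<Rightarrow> bool" where
  "transition_function q P \<longleftrightarrow>
     (\<forall>i. P 0 i = return_pmf i) \<and>
     (\<forall>s\<ge>0. \<forall>t\<ge>0. \<forall>i. P (s + t) i = bind_pmf (P s i) (P t)) \<and>
     (\<forall>i j. i \<noteq> j \<longrightarrow> ((\<lambda>t. pmf (P t i) j / t) \<longlongrightarrow> q i j) (at_right 0)) \<and>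
     (\<forall>i. ((\<lambda>t. (1 - pmf (P t i) i) / t) \<longlongrightarrow> (\<Sum>\<^sub>\<infinity>j\<in>- {i}. q i j)) (at_right 0))"

definition stationary_distribution :: "(real \<Rightarrow> 's \<Rightarrow> 's pmf) \<Rightarrow> 's pmf \<Rightarrow> bool" where
  "stationary_distribution P p \<longleftrightarrow> (\<forall>t\<ge>0. bind_pmf p (P t) = p)"

text \<open>Right-continuity of the paths refers to the discrete topology on the state space; it makes
  hitting events measurable.\<close>

definition markov_chain ::
  "'w measure \<Rightarrow> (real \<Rightarrow> 'w \<Rightarrow> 's) \<Rightarrow> 's pmf \<Rightarrow> (real \<Rightarrow> 's \<Rightarrow> 's pmf) \<Rightarrow> bool" where
  "markov_chain M X p P \<longleftrightarrow>
     prob_space M \<and>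
     (\<forall>t\<ge>0. X t \<in> measurable M (count_space UNIV)) \<and>
     (\<forall>\<omega>\<in>space M. \<forall>t\<ge>0. \<forall>\<^sub>F s in at_right t. X s \<omega> = X t \<omega>) \<and>
     (\<forall>n (t :: nat \<Rightarrow> real) x. t 0 = 0 \<and> mono t \<longrightarrow>
        measure M {\<omega> \<in> space M. \<forall>k\<le>n. X (t k) \<omega> = x k} =
        pmf p (x 0) * (\<Prod>k<n. pmf (P (t (Suc k) - t k) (x k)) (x (Suc k))))"

definition queue_rate :: "nat \<Rightarrow> real \<Rightarrow> real \<Rightarrow> real \<Rightarrow> nat \<Rightarrow> nat \<Rightarrow> real" where
  "queue_rate r lam \<mu> \<kappa> i j =
     (if j = i + 1 then lam else 0) +
     (if i \<ge> 1 \<and> j = i - 1 then real (min i r) * \<mu> else 0) +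
     (if i \<ge> 1 \<and> j = 0 then \<kappa> else 0)"

text \<open>
  The queue seen from an arriving (tagged) customer.
  \<open>Waiting a b\<close>: the tagged customer waits, with \<open>a\<close> customers ahead of it (in service or in line)
  and \<open>b\<close> customers who arrived later; as the discipline is first-come first-served, the busy
  servers are all occupied by customers ahead. Only states with \<open>a \<ge> r\<close> are reachable.
  \<open>Serving m\<close>: the tagged customer is in service and there are \<open>m\<close> other customers in the system.
  \<open>Completed\<close> and \<open>Cleared\<close>: it left by completing service, or by a resetting.
\<close>

datatype tagged_state = Waiting nat nat | Serving nat | Completed | Cleared

fun tagged_rate ::
  "nat \<Rightarrow> real \<Rightarrow> real \<Rightarrow> real \<Rightarrow> tagged_state \<Rightarrow> tagged_state \<Rightarrow> real" where
  "tagged_rate r lam \<mu> \<kappa> (Waiting a b) s =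
     (if s = Waiting a (b + 1) then lam else 0) +
     (if s = (if a \<le> r then Serving (a - 1 + b) else Waiting (a - 1) b)
      then real (min a r) * \<mu> else 0) +
     (if s = Cleared then \<kappa> else 0)"
| "tagged_rate r lam \<mu> \<kappa> (Serving m) s =
     (if s = Serving (m + 1) then lam else 0) +
     (if s = Completed then \<mu> else 0) +
     (if m \<ge> 1 \<and> s = Serving (m - 1) then real (min (m + 1) r - 1) * \<mu> else 0) +
     (if s = Cleared then \<kappa> else 0)"
| "tagged_rate r lam \<mu> \<kappa> Completed s = 0"
| "tagged_rate r lam \<mu> \<kappa> Cleared s = 0"

text \<open>State just after the arrival of a customer who finds \<open>n\<close> customers in the system.\<close>

definition arrival_state :: "nat \<Rightarrow> nat \<Rightarrow> tagged_state" where
  "arrival_state r n = (if n < r then Serving n else Waiting n 0)"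

definition delay_probability :: "nat \<Rightarrow> nat pmf \<Rightarrow> real" where
  "delay_probability r p = (\<Sum>\<^sub>\<infinity>n\<in>{r..}. pmf p n)"

definition completion_probability :: "'w measure \<Rightarrow> (real \<Rightarrow> 'w \<Rightarrow> tagged_state) \<Rightarrow> real" where
  "completion_probability M X = measure M {\<omega> \<in> space M. \<exists>t\<ge>0. X t \<omega> = Completed}"

text \<open>For a geometric tail \<open>p n = \<alpha> ^ (n - r + 1) * c\<close>, the weighted tail sum is
  \<open>(1 - \<alpha>) * r / ((1 - \<alpha>) * r + \<gamma>)\<close> times the tail sum. The factor with numerator
  \<open>(1 - \<alpha>) * \<gamma>\<close>, which is found in the literature, is correct only when \<open>\<gamma> = r\<close>.\<close>

lemma geometric_tail_sum:
  fixes x c :: real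
  assumes "0 < x" "x < 1"
  shows "(\<Sum>\<^sub>\<infinity>n\<in>{r..}. x ^ (n - r + 1) * c) = x / (1 - x) * c"
proof -
  have "(\<lambda>k. x ^ k) sums (1 / (1 - x))"
    using assms by (intro geometric_sums) auto
  then have "((\<lambda>k. x ^ k) has_sum (1 / (1 - x))) UNIV"
    using assms by (intro sums_nonneg_imp_has_sum) auto
  then have "((\<lambda>k. (x * c) * x ^ k) has_sum ((x * c) * (1 / (1 - x)))) UNIV"
    by (rule has_sum_cmult_right)
  then have s: "((\<lambda>k. x ^ (k + 1) * c) has_sum (x / (1 - x) * c)) UNIV"
    by (simp add: mult_ac)
  have r: "{r..} = (\<lambda>k. k + r) ` UNIV"
    using le_Suc_ex by (fastforce simp: image_iff add.commute)
  have "((\<lambda>n. x ^ (n - r + 1) * c) has_sum (x / (1 - x) * c)) {r..}"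
    unfolding r using s by (subst has_sum_reindex) (auto simp: o_def inj_on_def)
  then show ?thesis by (rule infsumI)
qed

lemma weighted_tail:
  fixes \<alpha> \<gamma> c :: real and r :: nat and p :: "nat \<Rightarrow> real"
  assumes "r \<ge> 1" "\<gamma> > 0" "0 < \<alpha>" "\<alpha> < 1" "c > 0"
    and p: "\<And>n. n \<ge> r \<Longrightarrow> p n = \<alpha> ^ (n - r + 1) * c"
  defines "S \<equiv> (\<Sum>\<^sub>\<infinity>n\<in>{r..}. p n * (real r / (real r + \<gamma>)) ^ (n - r + 1))"
    and "T \<equiv> (\<Sum>\<^sub>\<infinity>n\<in>{r..}. p n)"
  shows weighted_tail_eq: "S = (1 - \<alpha>) * real r / ((1 - \<alpha>) * real r + \<gamma>) * T"
    and weighted_tail_iff: "S = (1 - \<alpha>) * \<gamma> / ((1 - \<alpha>) * real r + \<gamma>) * T \<longleftrightarrow> \<gamma> = real r"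
proof -
  define y where "y = real r / (real r + \<gamma>)"
  define d where "d = (1 - \<alpha>) * real r + \<gamma>"
  have y: "0 < y" "y < 1" using assms by (auto simp: y_def)
  have ay: "0 < \<alpha> * y" "\<alpha> * y < 1"
    using y assms mult_strict_mono[of \<alpha> 1 y 1] by auto
  have d: "d > 0" using assms by (auto simp: d_def intro!: add_nonneg_pos)
  have T: "T = \<alpha> / (1 - \<alpha>) * c"
    unfolding T_def using assms geometric_tail_sum[of \<alpha> r c]
    by (subst infsum_cong[where g = "\<lambda>n. \<alpha> ^ (n - r + 1) * c"]) auto
  have "S = (\<alpha> * y) / (1 - \<alpha> * y) * c"
    unfolding S_def y_def[symmetric] using p ay geometric_tail_sum[of "\<alpha> * y" r c]
    by (subst infsum_cong[where g = "\<lambda>n. (\<alpha> * y) ^ (n - r + 1) * c"])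
       (auto simp: power_mult_distrib mult_ac)
  also have "1 - \<alpha> * y = d / (real r + \<gamma>)"
    using assms(1,2) by (simp add: y_def d_def field_simps)
  also have "(\<alpha> * y) / (d / (real r + \<gamma>)) * c = \<alpha> * real r / d * c"
    using assms(1,2) by (simp add: y_def add_pos_pos less_imp_neq[symmetric])
  finally have "S = \<alpha> * real r / d * c" .
  then show eq: "S = (1 - \<alpha>) * real r / ((1 - \<alpha>) * real r + \<gamma>) * T"
    unfolding d_def[symmetric] T using assms(3,4) d by (simp add: field_simps)
  have "T > 0" using assms(3-5) by (simp add: T)
  then have "S = (1 - \<alpha>) * \<gamma> / d * T \<longleftrightarrow> (1 - \<alpha>) * real r = (1 - \<alpha>) * \<gamma>"
    unfolding eq d_def[symmetric] using d by simp
  also have "\<dots> \<longleftrightarrow> \<gamma> = real r" using assms(4) by auto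
  finally show "S = (1 - \<alpha>) * \<gamma> / ((1 - \<alpha>) * real r + \<gamma>) * T \<longleftrightarrow> \<gamma> = real r"
    unfolding d_def .
qed

end

theory Submission
  imports Defs "HOL-Real_Asymp.Real_Asymp"
begin

text \<open>
  For a transition semigroup with bounded rates, \<open>t \<mapsto> E\<^sub>i f (X\<^sub>t)\<close> is differentiable with derivative
  \<open>E\<^sub>i (Q f) (X\<^sub>t)\<close> for every bounded \<open>f\<close>, where \<open>Q\<close> is the generator; hence the mean of \<open>Q f\<close>
  under a stationary distribution vanishes.

  Applied to the queue and the indicator of \<open>{n..}\<close>, this gives a second-order linear recursion for
  the tails of \<open>\<pi>\<close> beyond \<open>r - 1\<close>, with characteristic roots \<open>\<alpha> < 1 < \<beta>\<close>; boundedness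
  excludes \<open>\<beta>\<close>, so the tail of \<open>\<pi>\<close> is geometric with ratio \<open>\<alpha>\<close>.

  For the tagged customer, the claimed success probability \<open>h\<close> is harmonic (\<open>Q h = 0\<close>), so
  \<open>h s = E\<^sub>s h (X\<^sub>t)\<close>. As clearing occurs at rate at least \<open>\<kappa>\<close>, the chain is still transient at time
  \<open>t\<close> with probability at most \<open>exp (- \<kappa> * t)\<close>, and letting \<open>t\<close> tend to infinity identifies
  \<open>h s\<close> with the probability of absorption in \<open>Completed\<close>.
\<close>

section \<open>Transition semigroups with bounded rates\<close>

lemma integrable_bounded_pmf:
  fixes f :: "'a \<Rightarrow> real"
  assumes "\<And>x. \<bar>f x\<bar> \<le> B"
  shows "integrable (measure_pmf p) f"
  by (rule measure_pmf.integrable_const_bound[where B = B]) (auto simp: assms)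

lemma abs_expectation_le:
  fixes f :: "'a \<Rightarrow> real"
  assumes "\<And>x. \<bar>f x\<bar> \<le> B"
  shows "\<bar>measure_pmf.expectation p f\<bar> \<le> B"
proof -
  have "\<bar>measure_pmf.expectation p f\<bar> \<le> measure_pmf.expectation p (\<lambda>x. \<bar>f x\<bar>)"
    by (rule integral_abs_bound)
  also have "\<dots> \<le> measure_pmf.expectation p (\<lambda>_. B)"
    by (intro integral_mono integrable_bounded_pmf[where B = B] integrable_const)
       (auto simp: assms intro: order_trans[OF abs_ge_zero assms])
  finally show ?thesis by simp
qed

lemma expectation_bind_bounded:
  fixes f :: "'a \<Rightarrow> real"
  assumes "\<And>x. \<bar>f x\<bar> \<le> B"
  shows "measure_pmf.expectation (bind_pmf p K) f =
    measure_pmf.expectation p (\<lambda>x. measure_pmf.expectation (K x) f)"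
  unfolding measure_pmf_bind
  by (rule integral_bind[where K = "count_space UNIV" and B = B and B' = 1])
     (auto simp: assms measurable_measure_pmf measure_pmf_in_subprob_space)

text \<open>The difference \<open>f x - f i\<close> vanishes at \<open>i\<close> and is at most
  \<open>2 * B\<close> elsewhere, so only the mass off \<open>i\<close> contributes.\<close>

lemma abs_expectation_diff_le:
  fixes f :: "'a \<Rightarrow> real"
  assumes "\<And>x. \<bar>f x\<bar> \<le> B"
  shows "\<bar>measure_pmf.expectation p f - f i\<bar> \<le> 2 * B * (1 - pmf p i)"
proof -
  have b: "\<bar>f x - f i\<bar> \<le> 2 * B" for x
    using assms[of x] assms[of i] by linarith
  have B: "0 \<le> B" using assms[of i] by linarith
  have "measure_pmf.expectation p f - f i = measure_pmf.expectation p (\<lambda>x. f x - f i)"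
    using integrable_bounded_pmf[of f, OF assms] by simp
  also have "\<bar>\<dots>\<bar> \<le> measure_pmf.expectation p (\<lambda>x. \<bar>f x - f i\<bar>)"
    by (rule integral_abs_bound)
  also have "\<dots> \<le> measure_pmf.expectation p (\<lambda>x. 2 * B * indicator (- {i}) x)"
    using b B by (intro integral_mono integrable_bounded_pmf[where B = "2 * B"])
      (auto simp: indicator_def)
  also have "\<dots> = 2 * B * (1 - pmf p i)"
    using measure_pmf.prob_compl[of "{i}" p] by (simp add: measure_pmf_single Compl_eq_Diff_UNIV)
  finally show ?thesis .
qed

text \<open>Common frame for the queue and the tagged customer. The finite sets \<open>J i\<close>
  of possible targets turn the total exit rates into finite sums. The bound \<open>C\<close> makes
  every estimate uniform in the state, so that limits can be taken under an arbitrary initial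
  distribution.\<close>

locale jump_semigroup =
  fixes q :: "'s \<Rightarrow> 's \<Rightarrow> real" and P :: "real \<Rightarrow> 's \<Rightarrow> 's pmf"
    and J :: "'s \<Rightarrow> 's set" and C :: real
  assumes transition: "transition_function q P"
    and finite_J: "finite (J i)"
    and not_in_J: "i \<notin> J i"
    and rate_0: "j \<noteq> i \<Longrightarrow> j \<notin> J i \<Longrightarrow> q i j = 0"
    and rate_le: "(\<Sum>j\<in>J i. q i j) \<le> C"
begin

definition generator :: "('s \<Rightarrow> real) \<Rightarrow> 's \<Rightarrow> real" where
  "generator f i = (\<Sum>j\<in>J i. q i j * (f j - f i))"

lemma P_0: "P 0 i = return_pmf i"
  and P_add: "s \<ge> 0 \<Longrightarrow> t \<ge> 0 \<Longrightarrow> P (s + t) i = bind_pmf (P s i) (P t)"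
  and rate_limit: "i \<noteq> j \<Longrightarrow> ((\<lambda>t. pmf (P t i) j / t) \<longlongrightarrow> q i j) (at_right 0)"
  using transition unfolding transition_function_def by auto

lemma exit_rate_limit:
  "((\<lambda>t. (1 - pmf (P t i) i) / t) \<longlongrightarrow> (\<Sum>j\<in>J i. q i j)) (at_right 0)"
proof -
  have "(\<Sum>\<^sub>\<infinity>j\<in>- {i}. q i j) = (\<Sum>\<^sub>\<infinity>j\<in>J i. q i j)"
    by (rule infsum_cong_neutral) (use not_in_J rate_0 in auto)
  then show ?thesis
    using transition finite_J unfolding transition_function_def by (metis infsum_finite)
qed

text \<open>One way to be at \<open>i\<close> at time \<open>s + t\<close> is to be there at time
  \<open>s\<close> as well.\<close>

lemma pmf_stay_add:
  assumes "s \<ge> 0" "t \<ge> 0"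
  shows "pmf (P (s + t) i) i \<ge> pmf (P s i) i * pmf (P t i) i"
proof -
  have "pmf (P s i) i * pmf (P t i) i =
      measure_pmf.expectation (P s i) (\<lambda>x. pmf (P t i) i * indicator {i} x)"
    by (simp add: measure_pmf_single)
  also have "\<dots> \<le> measure_pmf.expectation (P s i) (\<lambda>x. pmf (P t x) i)"
    by (intro integral_mono integrable_bounded_pmf[where B = 1])
       (auto simp: indicator_def pmf_le_1)
  finally show ?thesis using assms by (simp add: P_add pmf_bind)
qed

text \<open>The probability of having left \<open>i\<close> is subadditive in time, so its slope at \<open>0\<close> bounds it.\<close>

lemma leave_le:
  assumes "t \<ge> 0"
  shows "1 - pmf (P t i) i \<le> (\<Sum>j\<in>J i. q i j) * t"
proof (cases "t = 0")
  case False
  with assms have t: "t > 0" by simp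
  have sub: "1 - pmf (P (s + u) i) i \<le> (1 - pmf (P s i) i) + (1 - pmf (P u i) i)"
    if "s \<ge> 0" "u \<ge> 0" for s u
  proof -
    \<comment> \<open>For staying probabilities a and b, (1 - a)(1 - b) \<ge> 0 rearranges to 1 - ab
      \<le> (1 - a) + (1 - b).\<close>
    have "0 \<le> (1 - pmf (P s i) i) * (1 - pmf (P u i) i)"
      by (simp add: pmf_le_1)
    then show ?thesis using pmf_stay_add[OF that, of i] by (simp add: algebra_simps)
  qed
  have mult: "1 - pmf (P (real n * h) i) i \<le> real n * (1 - pmf (P h i) i)" if "h \<ge> 0" for n h
  proof (induction n)
    case 0
    then show ?case by (simp add: P_0)
  next
    case (Suc n)
    then show ?case using sub[of "real n * h" h] that by (simp add: algebra_simps)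
  qed
  have lim: "filterlim (\<lambda>n. t / real (Suc n)) (at_right 0) sequentially"
    unfolding filterlim_at_right_to_0 filterlim_at
    using t LIMSEQ_Suc[OF lim_const_over_n[of t]] by auto
  have "(\<lambda>n. (1 - pmf (P (t / real (Suc n)) i) i) / (t / real (Suc n)) * t)
      \<longlonglongrightarrow> (\<Sum>j\<in>J i. q i j) * t"
    by (intro tendsto_mult_right filterlim_compose[OF exit_rate_limit lim])
  moreover have "1 - pmf (P t i) i \<le> (1 - pmf (P (t / real (Suc n)) i) i) / (t / real (Suc n)) * t" for n
    using mult[of "t / real (Suc n)" "Suc n"] t by (simp del: of_nat_Suc add: mult.commute)
  ultimately show ?thesis
    by (intro Lim_bounded2) auto
qed (simp add: P_0)

lemma leave_le_bound: "t \<ge> 0 \<Longrightarrow> 1 - pmf (P t i) i \<le> C * t"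
  using leave_le[of t i] mult_right_mono[OF rate_le[of i], of t] by linarith

lemma bound_nonneg: "C \<ge> 0"
  using leave_le_bound[of 1] pmf_le_1[of "P 1 undefined" undefined] by (smt (verit))

lemma increment_le:
  assumes "\<And>x. \<bar>f x\<bar> \<le> B" "t \<ge> 0"
  shows "\<bar>measure_pmf.expectation (P t i) f - f i\<bar> \<le> 2 * B * C * t"
proof -
  have "0 \<le> B" using assms(1)[of undefined] by linarith
  then have "2 * B * (1 - pmf (P t i) i) \<le> 2 * B * (C * t)"
    using leave_le_bound[OF assms(2), of i] by (intro mult_left_mono) auto
  then show ?thesis using abs_expectation_diff_le[of f B "P t i" i, OF assms(1)] by (simp add: mult.assoc)
qed

lemma expectation_add:
  fixes f :: "'s \<Rightarrow> real"
  assumes "\<And>x. \<bar>f x\<bar> \<le> B" "s \<ge> 0" "t \<ge> 0"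
  shows "measure_pmf.expectation (P (s + t) i) f =
    measure_pmf.expectation (P s i) (\<lambda>x. measure_pmf.expectation (P t x) f)"
  using assms by (simp add: P_add expectation_bind_bounded[where B = B])

text \<open>The targets in \<open>J i\<close> contribute their rates in the limit. The remainder
  \<open>R t\<close> lives off \<open>insert i (J i)\<close>, a set of probability o(t), because the
  slope at 0 of the leaving probability is exactly the sum of the rates into
  \<open>J i\<close>.\<close>

lemma generator_limit:
  assumes "\<And>x. \<bar>f x\<bar> \<le> B"
  shows "((\<lambda>t. (measure_pmf.expectation (P t i) f - f i) / t) \<longlongrightarrow> generator f i) (at_right 0)"
proof -
  define R where "R t = measure_pmf.expectation (P t i) (\<lambda>x. (f x - f i) * indicator (- J i) x)" for t
  have b: "\<bar>f x - f i\<bar> \<le> 2 * B" for x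
    using assms[of x] assms[of i] by linarith
  have B: "0 \<le> B" using assms[of i] by linarith
  have split: "measure_pmf.expectation (P t i) f - f i =
      (\<Sum>j\<in>J i. pmf (P t i) j * (f j - f i)) + R t" for t
  proof -
    have "measure_pmf.expectation (P t i) f - f i = measure_pmf.expectation (P t i) (\<lambda>x. f x - f i)"
      using integrable_bounded_pmf[of f, OF assms] by simp
    also have "(\<lambda>x. f x - f i) = (\<lambda>x. (f x - f i) * indicator (J i) x + (f x - f i) * indicator (- J i) x)"
      by (auto simp: indicator_def)
    also have "measure_pmf.expectation (P t i) \<dots> =
        measure_pmf.expectation (P t i) (\<lambda>x. (f x - f i) * indicator (J i) x) + R t"
      unfolding R_def using b B
      by (intro Bochner_Integration.integral_add integrable_bounded_pmf[where B = "2 * B"])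
         (auto simp: indicator_def)
    also have "measure_pmf.expectation (P t i) (\<lambda>x. (f x - f i) * indicator (J i) x) =
        (\<Sum>j\<in>J i. (f j - f i) * indicator (J i) j * pmf (P t i) j)"
      by (rule integral_measure_pmf_real) (auto simp: finite_J indicator_def split: if_splits)
    also have "\<dots> = (\<Sum>j\<in>J i. pmf (P t i) j * (f j - f i))"
      by (intro sum.cong) auto
    finally show ?thesis .
  qed
  have R: "\<bar>R t\<bar> \<le> 2 * B * ((1 - pmf (P t i) i) - (\<Sum>j\<in>J i. pmf (P t i) j))" for t
  proof -
    have "\<bar>R t\<bar> \<le> measure_pmf.expectation (P t i) (\<lambda>x. \<bar>(f x - f i) * indicator (- J i) x\<bar>)"
      unfolding R_def by (rule integral_abs_bound)
    \<comment> \<open>The state \<open>i\<close> lies outside \<open>J i\<close>, but there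
      \<open>f x - f i\<close> is zero, so it can be removed from the support too.\<close>
    also have "\<dots> \<le> measure_pmf.expectation (P t i) (\<lambda>x. 2 * B * indicator (- insert i (J i)) x)"
      using b B by (intro integral_mono integrable_bounded_pmf[where B = "2 * B"])
        (auto simp: indicator_def)
    also have "\<dots> = 2 * B * (1 - measure_pmf.prob (P t i) (insert i (J i)))"
      using measure_pmf.prob_compl[of "insert i (J i)" "P t i"] by (simp add: Compl_eq_Diff_UNIV)
    also have "measure_pmf.prob (P t i) (insert i (J i)) = pmf (P t i) i + (\<Sum>j\<in>J i. pmf (P t i) j)"
      using finite_J not_in_J by (simp add: measure_measure_pmf_finite)
    finally show ?thesis by (simp add: algebra_simps)
  qed
  have rates: "((\<lambda>t. pmf (P t i) j / t) \<longlongrightarrow> q i j) (at_right 0)" if "j \<in> J i" for j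
    using that not_in_J by (intro rate_limit) auto
  have "((\<lambda>t. R t / t) \<longlongrightarrow> 0) (at_right 0)"
  proof (rule Lim_null_comparison)
    show "((\<lambda>t. 2 * B * ((1 - pmf (P t i) i) / t - (\<Sum>j\<in>J i. pmf (P t i) j / t))) \<longlongrightarrow> 0) (at_right 0)"
    proof (rule tendsto_eq_rhs)
      show "((\<lambda>t. 2 * B * ((1 - pmf (P t i) i) / t - (\<Sum>j\<in>J i. pmf (P t i) j / t))) \<longlongrightarrow>
          2 * B * ((\<Sum>j\<in>J i. q i j) - (\<Sum>j\<in>J i. q i j))) (at_right 0)"
        by (intro tendsto_mult_left tendsto_diff tendsto_sum exit_rate_limit rates)
    qed simp
    show "\<forall>\<^sub>F t in at_right 0. norm (R t / t) \<le>
        2 * B * ((1 - pmf (P t i) i) / t - (\<Sum>j\<in>J i. pmf (P t i) j / t))"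
      unfolding eventually_at_filter
    proof (intro always_eventually allI impI)
      fix t :: real assume t: "t \<in> {0<..}"
      have "norm (R t / t) = \<bar>R t\<bar> / t" using t by simp
      also have "\<dots> \<le> 2 * B * ((1 - pmf (P t i) i) - (\<Sum>j\<in>J i. pmf (P t i) j)) / t"
        using t by (intro divide_right_mono R) auto
      also have "\<dots> = 2 * B * ((1 - pmf (P t i) i) / t - (\<Sum>j\<in>J i. pmf (P t i) j / t))"
        by (simp add: diff_divide_distrib[symmetric] sum_divide_distrib[symmetric])
      finally show "norm (R t / t) \<le> 2 * B * ((1 - pmf (P t i) i) / t - (\<Sum>j\<in>J i. pmf (P t i) j / t))" .
    qed
  qed
  then have "((\<lambda>t. (\<Sum>j\<in>J i. pmf (P t i) j / t * (f j - f i)) + R t / t) \<longlongrightarrow> generator f i + 0) (at_right 0)"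
    unfolding generator_def by (intro tendsto_intros rates)
  then show ?thesis
    by (simp add: split add_divide_distrib sum_divide_distrib)
qed

text \<open>By \<open>increment_le\<close> the difference quotients are dominated by the constant
  \<open>2 * B * C\<close>; the limit is taken along sequences to apply dominated
  convergence.\<close>

lemma expectation_generator_limit:
  assumes "\<And>x. \<bar>f x\<bar> \<le> B"
  shows "((\<lambda>t. measure_pmf.expectation p (\<lambda>i. (measure_pmf.expectation (P t i) f - f i) / t))
    \<longlongrightarrow> measure_pmf.expectation p (generator f)) (at_right 0)"
  unfolding tendsto_at_iff_sequentially comp_def
proof (intro allI impI)
  fix X :: "nat \<Rightarrow> real" assume X: "\<forall>i. X i \<in> {0<..} - {0}" "X \<longlonglongrightarrow> 0"
  show "(\<lambda>n. measure_pmf.expectation p (\<lambda>i. (measure_pmf.expectation (P (X n) i) f - f i) / X n))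
      \<longlonglongrightarrow> measure_pmf.expectation p (generator f)"
  proof (rule integral_dominated_convergence[where w = "\<lambda>_. 2 * B * C"])
    show "AE i in p. (\<lambda>n. (measure_pmf.expectation (P (X n) i) f - f i) / X n) \<longlonglongrightarrow> generator f i"
      using generator_limit[of f B, OF assms] X
      unfolding tendsto_at_iff_sequentially comp_def by (intro AE_I2) blast
    have "0 < X n" for n using X(1) by auto
    then show "AE i in p. norm ((measure_pmf.expectation (P (X n) i) f - f i) / X n) \<le> 2 * B * C" for n
      by (intro AE_I2) (simp add: pos_divide_le_eq increment_le[of f B "X n", OF assms] less_imp_le)
  qed auto
qed

text \<open>Stationarity makes the mean of the difference quotient zero for each
  \<open>t > 0\<close>, hence also in the limit.\<close>

lemma stationary_generator:
  assumes "stationary_distribution P p" "\<And>x. \<bar>f x\<bar> \<le> B"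
  shows "measure_pmf.expectation p (generator f) = 0"
proof -
  have "measure_pmf.expectation p (\<lambda>i. (measure_pmf.expectation (P t i) f - f i) / t) = 0"
    if "t > 0" for t
  proof -
    have "measure_pmf.expectation p (\<lambda>i. measure_pmf.expectation (P t i) f) = measure_pmf.expectation p f"
      using assms that expectation_bind_bounded[of f B p "P t"]
      by (simp add: stationary_distribution_def)
    moreover have "integrable p f" "integrable p (\<lambda>i. measure_pmf.expectation (P t i) f)"
      using assms(2) by (auto intro!: integrable_bounded_pmf[where B = B] abs_expectation_le)
    ultimately show ?thesis by simp
  qed
  then have "((\<lambda>t. measure_pmf.expectation p (\<lambda>i. (measure_pmf.expectation (P t i) f - f i) / t))
      \<longlongrightarrow> 0) (at_right 0)"
    by (intro tendsto_eventually) (auto simp: eventually_at_filter)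
  with expectation_generator_limit[of f B p, OF assms(2)] show ?thesis
    by (intro tendsto_unique) auto
qed

section \<open>Dependence of expectations on time\<close>

lemma expectation_lipschitz:
  fixes f :: "'s \<Rightarrow> real"
  assumes "\<And>x. \<bar>f x\<bar> \<le> B" "s \<ge> 0" "h \<ge> 0"
  shows "\<bar>measure_pmf.expectation (P (s + h) i) f - measure_pmf.expectation (P s i) f\<bar> \<le> 2 * B * C * h"
proof -
  have "measure_pmf.expectation (P (s + h) i) f - measure_pmf.expectation (P s i) f =
      measure_pmf.expectation (P s i) (\<lambda>x. measure_pmf.expectation (P h x) f - f x)"
    using assms
    by (simp add: expectation_add[where B = B] integrable_bounded_pmf[where B = B]
        abs_expectation_le[where B = B])
  also have "\<bar>\<dots>\<bar> \<le> 2 * B * C * h"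
    by (intro abs_expectation_le increment_le[of f B h, OF assms(1,3)])
  finally show ?thesis .
qed

text \<open>A limit of quotients that \<open>increment_le\<close> bounds. It provides the
  integrability of \<open>generator f\<close>.\<close>

lemma generator_bound:
  assumes "\<And>x. \<bar>f x\<bar> \<le> B"
  shows "\<bar>generator f i\<bar> \<le> 2 * B * C"
proof (rule tendsto_upperbound)
  show "((\<lambda>t. \<bar>(measure_pmf.expectation (P t i) f - f i) / t\<bar>) \<longlongrightarrow> \<bar>generator f i\<bar>) (at_right 0)"
    by (intro tendsto_rabs generator_limit[of f B, OF assms])
  show "\<forall>\<^sub>F t in at_right 0. \<bar>(measure_pmf.expectation (P t i) f - f i) / t\<bar> \<le> 2 * B * C"
    using increment_le[of f B, OF assms]
    by (auto simp: eventually_at_filter pos_divide_le_eq)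
qed simp

text \<open>Only right derivatives come from the generator limit. The left quotient at \<open>t\<close> is the right
  quotient at \<open>t - h\<close>, and the Lipschitz estimate compares it with the one at \<open>t\<close>.\<close>

lemma expectation_derivative:
  assumes B: "\<And>x. \<bar>f x\<bar> \<le> B" and "t > 0"
  shows "((\<lambda>t. measure_pmf.expectation (P t i) f) has_real_derivative
    measure_pmf.expectation (P t i) (generator f)) (at t)"
proof -
  define u where "u t = measure_pmf.expectation (P t i) f" for t
  define D where "D h x = (measure_pmf.expectation (P h x) f - f x) / h" for h x
  define G where "G = measure_pmf.expectation (P t i) (generator f)"
  have quotient: "(u (s + h) - u s) / h = measure_pmf.expectation (P s i) (D h)"
    if "s \<ge> 0" "h > 0" for s h
    using that B unfolding u_def D_def
    by (simp add: expectation_add[where B = B] integrable_bounded_pmf[where B = B]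
        abs_expectation_le[where B = B])
  have D: "\<bar>D h x\<bar> \<le> 2 * B * C" if "h > 0" for h x
    using increment_le[of f B h x, OF B] that by (simp add: D_def pos_divide_le_eq)
  have small: "\<forall>\<^sub>F h in at_right 0. 0 < h \<and> h < t"
    using \<open>t > 0\<close> by (intro eventually_at_rightI[of 0 t]) auto
  have lim: "((\<lambda>h. measure_pmf.expectation (P t i) (D h)) \<longlongrightarrow> G) (at_right 0)"
    unfolding D_def G_def by (rule expectation_generator_limit[OF B])
  have right: "((\<lambda>h. (u (t + h) - u t) / h) \<longlongrightarrow> G) (at_right 0)"
    using lim by (rule Lim_transform_eventually)
      (use \<open>t > 0\<close> quotient in \<open>auto simp: eventually_at_filter\<close>)
  have "((\<lambda>h. measure_pmf.expectation (P (t - h) i) (D h) - measure_pmf.expectation (P t i) (D h))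
      \<longlongrightarrow> 0) (at_right 0)"
  proof (rule Lim_null_comparison)
    \<comment> \<open>The constant is that of \<open>expectation_lipschitz\<close> for the function
      \<open>D h\<close>, which is itself bounded by \<open>2 * B * C\<close>.\<close>
    show "((\<lambda>h. 2 * (2 * B * C) * C * h) \<longlongrightarrow> 0) (at_right 0)"
      by (intro tendsto_mult_right_zero tendsto_ident_at)
    show "\<forall>\<^sub>F h in at_right 0. norm (measure_pmf.expectation (P (t - h) i) (D h) -
        measure_pmf.expectation (P t i) (D h)) \<le> 2 * (2 * B * C) * C * h"
      using small
    proof eventually_elim
      case (elim h)
      then show ?case
        using expectation_lipschitz[of "D h" "2 * B * C" "t - h" h i] D by (simp add: abs_minus_commute)
    qed
  qed
  from tendsto_add[OF this lim]
  have "((\<lambda>h. measure_pmf.expectation (P (t - h) i) (D h)) \<longlongrightarrow> G) (at_right 0)"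
    by simp
  then have "((\<lambda>h. (u (t - h) - u t) / (- h)) \<longlongrightarrow> G) (at_right 0)"
  proof (rule Lim_transform_eventually)
    show "\<forall>\<^sub>F h in at_right 0. measure_pmf.expectation (P (t - h) i) (D h) = (u (t - h) - u t) / (- h)"
      using small
    proof eventually_elim
      case (elim h)
      then show ?case using quotient[of "t - h" h] by (simp add: field_simps)
    qed
  qed
  then have "((\<lambda>h. (u (t + h) - u t) / h) \<longlongrightarrow> G) (at_left 0)"
    unfolding filterlim_at_left_to_right by simp
  with right show ?thesis
    unfolding DERIV_def u_def[symmetric] G_def[symmetric] by (rule filterlim_split_at[rotated])
qed

lemma expectation_continuous:
  fixes f :: "'s \<Rightarrow> real"
  assumes "\<And>x. \<bar>f x\<bar> \<le> B"
  shows "continuous_on {0..} (\<lambda>t. measure_pmf.expectation (P t i) f)"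
proof (rule lipschitz_on_continuous_on)
  have B: "0 \<le> B" using assms[of undefined] by linarith
  have "\<bar>measure_pmf.expectation (P s i) f - measure_pmf.expectation (P t i) f\<bar> \<le> 2 * B * C * \<bar>s - t\<bar>"
    if "s \<ge> 0" "t \<ge> 0" for s t
    using expectation_lipschitz[of f B s "t - s" i, OF assms]
      expectation_lipschitz[of f B t "s - t" i, OF assms] that
    by (cases "s \<le> t") (auto simp: abs_minus_commute)
  then show "(2 * B * C)-lipschitz_on {0..} (\<lambda>t. measure_pmf.expectation (P t i) f)"
    using B bound_nonneg by (auto intro!: lipschitz_onI simp: dist_real_def)
qed

text \<open>Gronwall argument: the derivative of \<open>exp (k * t) * u t\<close> is
  \<open>exp (k * t)\<close> times the mean of \<open>k * f + generator f\<close>, which is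
  nonpositive.\<close>

lemma expectation_le_exp:
  fixes f :: "'s \<Rightarrow> real"
  assumes B: "\<And>x. \<bar>f x\<bar> \<le> B" and gen: "\<And>x. generator f x \<le> - k * f x" and "t \<ge> 0"
  shows "measure_pmf.expectation (P t i) f \<le> exp (- k * t) * f i"
proof -
  define u where "u t = measure_pmf.expectation (P t i) f" for t
  have "exp (k * t) * u t \<le> exp (k * 0) * u 0"
  proof (rule DERIV_nonpos_imp_decreasing_open[OF \<open>t \<ge> 0\<close>])
    \<comment> \<open>The derivative is available only at positive times; continuity covers the
      endpoint 0.\<close>
    fix s :: real assume "0 < s"
    have "((\<lambda>s. exp (k * s) * u s) has_real_derivative
        exp (k * s) * (k * u s + measure_pmf.expectation (P s i) (generator f))) (at s)"
      unfolding u_def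
      by (rule derivative_eq_intros expectation_derivative[OF B \<open>0 < s\<close>] refl)+
         (simp add: algebra_simps)
    moreover have "measure_pmf.expectation (P s i) (generator f) \<le> measure_pmf.expectation (P s i) (\<lambda>x. - k * f x)"
      using generator_bound[of f B, OF B] gen B
      by (intro integral_mono integrable_bounded_pmf[where B = "2 * B * C"] integrable_mult_right
          integrable_bounded_pmf[where B = B])
    then have "k * u s + measure_pmf.expectation (P s i) (generator f) \<le> 0"
      by (simp add: u_def)
    then have "exp (k * s) * (k * u s + measure_pmf.expectation (P s i) (generator f)) \<le> 0"
      by (simp add: mult_le_0_iff)
    ultimately show "\<exists>y. ((\<lambda>s. exp (k * s) * u s) has_real_derivative y) (at s) \<and> y \<le> 0"
      by blast
  next
    show "continuous_on {0..t} (\<lambda>s. exp (k * s) * u s)"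
      unfolding u_def
      by (intro continuous_intros continuous_on_subset[OF expectation_continuous[OF B]]) auto
  qed
  then have "exp (k * t) * u t \<le> f i" by (simp add: u_def P_0)
  then show ?thesis by (simp add: u_def exp_minus field_simps)
qed

text \<open>The exponential bound with rate 0, applied to \<open>f\<close> and to its
  negative.\<close>

lemma expectation_harmonic:
  fixes f :: "'s \<Rightarrow> real"
  assumes B: "\<And>x. \<bar>f x\<bar> \<le> B" and gen: "\<And>x. generator f x = 0" and "t \<ge> 0"
  shows "measure_pmf.expectation (P t i) f = f i"
proof -
  have "generator (\<lambda>x. - f x) x = - generator f x" for x
    by (simp add: generator_def sum_negf[symmetric] algebra_simps)
  then show ?thesis
    using expectation_le_exp[of f B 0 t i] expectation_le_exp[of "\<lambda>x. - f x" B 0 t i] assms by simp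
qed

end

section \<open>Absorption of right-continuous chains\<close>

text \<open>The finite-dimensional laws are given only for paths observed from time 0. So the
  initial state \<open>x\<close> is fixed first, and the disjoint events \<open>A x\<close> are then
  summed over the countable state space.\<close>

lemma markov_chain_joint:
  fixes X :: "real \<Rightarrow> 'w \<Rightarrow> 's :: countable"
  assumes chain: "markov_chain M X p P" and "0 \<le> s" "s \<le> t"
  shows "measure M {\<omega> \<in> space M. X s \<omega> = a \<and> X t \<omega> = b} =
    pmf (bind_pmf p (P s)) a * pmf (P (t - s) a) b"
proof -
  interpret prob_space M using chain by (simp add: markov_chain_def)
  have X [measurable]: "X u \<in> measurable M (count_space UNIV)" if "u \<ge> 0" for u
    using chain that by (simp add: markov_chain_def)
  define A where "A x = {\<omega> \<in> space M. X 0 \<omega> = x \<and> X s \<omega> = a \<and> X t \<omega> = b}" for x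
  have A_sets: "A x \<in> events" for x
  proof -
    have [measurable]: "X 0 \<in> measurable M (count_space UNIV)" "X s \<in> measurable M (count_space UNIV)"
      "X t \<in> measurable M (count_space UNIV)" using assms by (auto intro!: X)
    show ?thesis unfolding A_def by measurable
  qed
  have A: "emeasure M (A x) = ennreal (pmf p x) * ennreal (pmf (P s x) a * pmf (P (t - s) a) b)" for x
  proof -
    \<comment> \<open>Only the indices 0, 1, 2 enter the event; continuing with \<open>t\<close>
      keeps the sequence of times monotone.\<close>
    define \<tau> where "\<tau> k = (if k = 0 then 0 else if k = 1 then s else t)" for k :: nat
    define y where "y k = (if k = 0 then x else if k = 1 then a else b)" for k :: nat
    have "\<tau> 0 = 0" "mono \<tau>"
      using assms by (auto simp: \<tau>_def intro!: monoI)
    then have "measure M {\<omega> \<in> space M. \<forall>k\<le>2. X (\<tau> k) \<omega> = y k} =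
        pmf p (y 0) * (\<Prod>k<2. pmf (P (\<tau> (Suc k) - \<tau> k) (y k)) (y (Suc k)))"
      using chain unfolding markov_chain_def by blast
    moreover have "{\<omega> \<in> space M. \<forall>k\<le>2. X (\<tau> k) \<omega> = y k} = A x"
      by (auto simp: A_def \<tau>_def y_def le_Suc_eq numeral_2_eq_2)
    moreover have "(\<Prod>k<2. pmf (P (\<tau> (Suc k) - \<tau> k) (y k)) (y (Suc k))) =
        pmf (P s x) a * pmf (P (t - s) a) b"
      by (simp add: numeral_2_eq_2 \<tau>_def y_def)
    ultimately show ?thesis
      by (simp add: emeasure_eq_measure y_def ennreal_mult)
  qed
  have "{\<omega> \<in> space M. X s \<omega> = a \<and> X t \<omega> = b} = \<Union> (range A)"
    by (auto simp: A_def)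
  then have "emeasure M {\<omega> \<in> space M. X s \<omega> = a \<and> X t \<omega> = b} =
      (\<integral>\<^sup>+x. emeasure M (A x) \<partial>count_space UNIV)"
    using A_sets by (simp add: emeasure_UN_countable disjoint_family_on_def A_def[abs_def] Int_def)
  also have "\<dots> = (\<integral>\<^sup>+x. ennreal (pmf (P s x) a * pmf (P (t - s) a) b) \<partial>p)"
    by (simp add: A nn_integral_measure_pmf)
  also have "\<dots> = ennreal (pmf (bind_pmf p (P s)) a * pmf (P (t - s) a) b)"
    by (simp add: ennreal_mult nn_integral_multc ennreal_pmf_bind)
  finally show ?thesis
    by (simp add: emeasure_eq_measure)
qed

text \<open>Absorption is known only for the transition probabilities, so a path remains at
  \<open>c\<close> almost surely for each pair of times. Right-continuity reduces the hitting event
  to rational times, where countably many null sets suffice. Then the indicators of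
  \<open>X n = c\<close> converge almost surely to the indicator of hitting
  \<open>c\<close>.\<close>

lemma absorption_limit:
  fixes X :: "real \<Rightarrow> 'w \<Rightarrow> 's :: countable"
  assumes chain: "markov_chain M X p P" and absorbing: "\<And>t. t \<ge> 0 \<Longrightarrow> pmf (P t c) c = 1"
    and P_0: "\<And>i. P 0 i = return_pmf i"
  shows "(\<lambda>n. pmf (bind_pmf p (P (real n))) c) \<longlonglongrightarrow> measure M {\<omega> \<in> space M. \<exists>t\<ge>0. X t \<omega> = c}"
proof -
  interpret prob_space M using chain by (simp add: markov_chain_def)
  have X [measurable]: "X u \<in> measurable M (count_space UNIV)" if "u \<ge> 0" for u
    using chain that by (simp add: markov_chain_def)
  define A where "A t = {\<omega> \<in> space M. X t \<omega> = c}" for t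
  define E where "E = {\<omega> \<in> space M. \<exists>t\<ge>0. X t \<omega> = c}"
  have A_sets [measurable]: "A t \<in> events" if "t \<ge> 0" for t
    using measurable_sets[OF X[OF that], of "{c}"] by (simp add: A_def vimage_def Int_def conj_commute)
  have joint: "measure M {\<omega> \<in> space M. X s \<omega> = c \<and> X t \<omega> = c} = pmf (bind_pmf p (P s)) c"
    if "0 \<le> s" "s \<le> t" for s t
    using markov_chain_joint[OF chain that, of c c] that by (simp add: absorbing)
  have prob_A: "prob (A s) = pmf (bind_pmf p (P s)) c" if "0 \<le> s" for s
    using joint[OF that order_refl] by (simp add: A_def)
  have stay: "AE \<omega> in M. X s \<omega> = c \<longrightarrow> X t \<omega> = c" if "0 \<le> s" "s \<le> t" for s t
  proof -
    have "prob (A s \<inter> A t) = prob (A s)"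
      using joint[OF that] prob_A[OF that(1)] by (simp add: A_def Int_def conj_ac)
    then have "prob (A s - A t) = 0"
      using that finite_measure_Diff'[of "A s" "A t"] by auto
    moreover have "A s - A t \<in> events" using that by auto
    ultimately have "AE \<omega> in M. \<omega> \<notin> A s - A t"
      by (subst (asm) prob_eq_0) auto
    then show ?thesis by (rule AE_mp) (auto simp: A_def)
  qed
  \<comment> \<open>A path that is at \<open>c\<close> at time \<open>t\<close> stays there on an
    interval to the right of \<open>t\<close>, which contains a rational.\<close>
  have rational: "\<exists>q\<ge>0. X (real_of_rat q) \<omega> = c" if \<omega>: "\<omega> \<in> E" for \<omega>
  proof -
    obtain t where t: "t \<ge> 0" "X t \<omega> = c" "\<omega> \<in> space M" using \<omega> by (auto simp: E_def)
    then have "\<forall>\<^sub>F s in at_right t. X s \<omega> = c"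
      using chain unfolding markov_chain_def by metis
    then obtain b where "b > t" "\<And>s. t < s \<Longrightarrow> s < b \<Longrightarrow> X s \<omega> = c"
      unfolding eventually_at_right_field by blast
    moreover obtain q where "t < real_of_rat q" "real_of_rat q < b"
      using of_rat_dense[OF \<open>b > t\<close>] by blast
    moreover have "real_of_rat q \<ge> 0" using t(1) calculation by linarith
    ultimately have "X (real_of_rat q) \<omega> = c" "real_of_rat q \<ge> 0" by blast+
    then show ?thesis by (metis zero_le_of_rat_iff)
  qed
  have "E = (\<Union>q\<in>{0..}. A (real_of_rat q))"
    using rational by (auto simp: E_def A_def) (metis zero_le_of_rat_iff)
  then have E [measurable]: "E \<in> events"
    by (auto intro!: sets.countable_UN')
  have "AE \<omega> in M. \<forall>q. \<forall>n. 0 \<le> real_of_rat q \<longrightarrow> real_of_rat q \<le> real n \<longrightarrow>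
      X (real_of_rat q) \<omega> = c \<longrightarrow> X (real n) \<omega> = c"
    unfolding AE_all_countable
  proof (intro allI)
    fix q n
    show "AE \<omega> in M. 0 \<le> real_of_rat q \<longrightarrow> real_of_rat q \<le> real n \<longrightarrow>
        X (real_of_rat q) \<omega> = c \<longrightarrow> X (real n) \<omega> = c"
      using stay[of "real_of_rat q" "real n"]
      by (cases "0 \<le> real_of_rat q \<and> real_of_rat q \<le> real n") auto
  qed
  then have "AE \<omega> in M. (\<lambda>n. indicat_real (A (real n)) \<omega>) \<longlonglongrightarrow> indicat_real E \<omega>"
  proof (rule AE_mp, intro AE_I2 impI)
    fix \<omega> assume \<omega>: "\<omega> \<in> space M"
      and mono: "\<forall>q n. 0 \<le> real_of_rat q \<longrightarrow> real_of_rat q \<le> real n \<longrightarrow>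
        X (real_of_rat q) \<omega> = c \<longrightarrow> X (real n) \<omega> = c"
    show "(\<lambda>n. indicat_real (A (real n)) \<omega>) \<longlonglongrightarrow> indicat_real E \<omega>"
    proof (cases "\<omega> \<in> E")
      case True
      then obtain q where q: "q \<ge> 0" "X (real_of_rat q) \<omega> = c" using rational by blast
      have "\<forall>\<^sub>F n in sequentially. real_of_rat q \<le> real n"
        using filterlim_real_sequentially by (simp add: filterlim_at_top)
      then have "\<forall>\<^sub>F n in sequentially. indicat_real (A (real n)) \<omega> = indicat_real E \<omega>"
        by eventually_elim (use mono q \<omega> True in \<open>auto simp: A_def\<close>)
      then show ?thesis by (rule tendsto_eventually)
    next
      case False
      then have "\<omega> \<notin> A (real n)" for n by (auto simp: A_def E_def)
      with False show ?thesis by simp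
    qed
  qed
  then have "(\<lambda>n. integral\<^sup>L M (indicat_real (A (real n)))) \<longlonglongrightarrow> integral\<^sup>L M (indicat_real E)"
    by (intro integral_dominated_convergence[where w = "\<lambda>_. 1"]) (auto simp: indicator_def)
  moreover have "integral\<^sup>L M (indicat_real (A (real n))) = pmf (bind_pmf p (P (real n))) c" for n
    using prob_A[of "real n"] sets.sets_into_space[OF A_sets[of "real n"]] by (simp add: Int_absorb2)
  ultimately show ?thesis
    using sets.sets_into_space[OF E] by (simp add: Int_absorb2 E_def)
qed

text \<open>Comparison with \<open>B * pmf p x\<close>. It lets an expectation over the queue length
  be split at \<open>r\<close> into two sums.\<close>

lemma pmf_expectation_has_sum:
  fixes f :: "'a \<Rightarrow> real"
  assumes "\<And>x. \<bar>f x\<bar> \<le> B"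
  shows "((\<lambda>x. pmf p x * f x) has_sum measure_pmf.expectation p f) UNIV"
proof -
  have "Infinite_Set_Sum.abs_summable_on (\<lambda>x. pmf p x * f x) UNIV"
  proof (rule abs_summable_on_comparison_test)
    show "Infinite_Set_Sum.abs_summable_on (\<lambda>x. B * pmf p x) UNIV"
      by (intro abs_summable_on_cmult_right) auto
    show "norm (pmf p x * f x) \<le> norm (B * pmf p x)" for x
      using mult_right_mono[OF order_trans[OF assms abs_ge_self], of "pmf p x" x] by (simp add: abs_mult mult.commute)
  qed
  then show ?thesis
    unfolding pmf_expectation_eq_infsetsum
    by (metis abs_summable_equivalent abs_summable_summable has_sum_infsum infsetsum_infsum)
qed

section \<open>The stationary distribution of the queue\<close>

text \<open>\<open>H\<close> removes the root \<open>a\<close> from the recursion, leaving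
  \<open>H (n + 1) = b * H n\<close>. As \<open>b > 1\<close>, a nonzero \<open>H m\<close> would
  grow beyond the bound inherited from \<open>G\<close>; so \<open>H\<close> vanishes from
  \<open>m\<close> on.\<close>

lemma geometric_recursion:
  fixes G :: "nat \<Rightarrow> real"
  assumes rec: "\<And>n. n \<ge> m \<Longrightarrow> G (n + 2) = (a + b) * G (n + 1) - a * b * G n"
    and b: "b > 1" and bounded: "\<And>n. \<bar>G n\<bar> \<le> B"
  shows "G (m + k) = a ^ k * G m"
proof -
  define H where "H n = G (n + 1) - a * G n" for n
  have H: "H (m + k) = b ^ k * H m" for k
  proof (induction k)
    case (Suc k)
    have "H (m + Suc k) = b * H (m + k)"
      using rec[of "m + k"] by (simp add: H_def algebra_simps)
    with Suc show ?case by simp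
  qed simp
  have H_bound: "\<bar>H n\<bar> \<le> B + \<bar>a\<bar> * B" for n
  proof -
    have "\<bar>H n\<bar> \<le> \<bar>G (n + 1)\<bar> + \<bar>a\<bar> * \<bar>G n\<bar>"
      unfolding H_def by (rule order_trans[OF abs_triangle_ineq4]) (simp add: abs_mult)
    also have "\<dots> \<le> B + \<bar>a\<bar> * B"
      by (intro add_mono bounded mult_left_mono) auto
    finally show ?thesis .
  qed
  have "H m = 0"
  proof (rule ccontr)
    assume "H m \<noteq> 0"
    obtain k where "(B + \<bar>a\<bar> * B) / \<bar>H m\<bar> < b ^ k"
      using real_arch_pow[OF b] by blast
    then have "B + \<bar>a\<bar> * B < \<bar>H (m + k)\<bar>"
      using \<open>H m \<noteq> 0\<close> b by (simp add: H abs_mult pos_divide_less_eq)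
    with H_bound[of "m + k"] show False by simp
  qed
  then have step: "G (m + Suc k) = a * G (m + k)" for k
    using H[of k] by (simp add: H_def)
  show ?thesis
    by (induction k) (simp_all add: step del: add_Suc_right)
qed

text \<open>\<alpha> and \<beta> are the roots of R x^2 - (R + \<theta> + \<gamma>) x + \<theta>.
  Its value at 1 is -\<gamma> < 0, so 1 lies strictly between them; in terms of the discriminant
  this is \<open>\<bar>s - 2 * R\<bar> < sqrt D\<close>.\<close>

lemma alpha_roots:
  fixes R \<theta> \<gamma> \<alpha> :: real
  assumes "R > 0" "\<theta> > 0" "\<gamma> > 0"
    and \<alpha>: "\<alpha> = (R + \<theta> + \<gamma> - sqrt ((R + \<theta> + \<gamma>)\<^sup>2 - 4 * \<theta> * R)) / (2 * R)"
  obtains \<beta> where "0 < \<alpha>" "\<alpha> < 1" "1 < \<beta>" "R * (\<alpha> + \<beta>) = R + \<theta> + \<gamma>" "R * (\<alpha> * \<beta>) = \<theta>"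
proof
  define s where "s = R + \<theta> + \<gamma>"
  define D where "D = s\<^sup>2 - 4 * \<theta> * R"
  define \<beta> where "\<beta> = (s + sqrt D) / (2 * R)"
  have pos: "0 < R * \<theta>" "0 < R * \<gamma>" "0 < \<theta> * \<gamma>" using assms by auto
  have "D = (R - \<theta>)\<^sup>2 + \<gamma>\<^sup>2 + 2 * (R * \<gamma>) + 2 * (\<theta> * \<gamma>)"
    by (simp add: D_def s_def power2_eq_square algebra_simps)
  then have D: "D > 0" using pos by (simp add: add_nonneg_pos)
  have "(s - 2 * R)\<^sup>2 = D - 4 * (R * \<gamma>)"
    by (simp add: D_def s_def power2_eq_square algebra_simps)
  then have "\<bar>s - 2 * R\<bar> < sqrt D"
    using pos by (intro real_less_rsqrt) simp
  then have lt: "s - sqrt D < 2 * R" "2 * R < s + sqrt D" by linarith+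
  have "D < s\<^sup>2" using pos by (simp add: D_def mult.commute)
  then have "sqrt D < s" using assms by (intro real_less_lsqrt) (auto simp: s_def)
  then show "0 < \<alpha>" using assms by (simp add: \<alpha> s_def D_def)
  show "\<alpha> < 1" using lt assms by (simp add: \<alpha> s_def D_def)
  show "1 < \<beta>" using lt assms by (simp add: \<beta>_def)
  show "R * (\<alpha> + \<beta>) = R + \<theta> + \<gamma>"
    using assms(1) by (simp add: \<alpha> \<beta>_def s_def D_def field_simps)
  have "\<alpha> = (s - sqrt D) / (2 * R)"
    by (simp add: \<alpha> s_def D_def)
  then have "\<alpha> * \<beta> = (s\<^sup>2 - (sqrt D)\<^sup>2) / (4 * R\<^sup>2)"
    by (simp add: \<beta>_def square_diff_square_factored power2_eq_square mult.commute del: real_sqrt_mult_self)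
  also have "\<dots> = \<theta> / R"
    using D assms(1) by (simp add: D_def power2_eq_square)
  finally show "R * (\<alpha> * \<beta>) = \<theta>"
    using assms(1) by simp
qed

text \<open>State 0 is separate because truncated subtraction would make it a target of itself. From
  state 1, service and resetting share the target 0 and their rates add up.\<close>

definition queue_jumps :: "nat \<Rightarrow> nat set" where
  "queue_jumps i = (if i = 0 then {1} else {i + 1, i - 1, 0})"

lemma sum_queue_rate:
  "(\<Sum>j\<in>queue_jumps i. queue_rate r lam \<mu> \<kappa> i j * g j) =
    lam * g (i + 1) + (if i = 0 then 0 else real (min i r) * \<mu> * g (i - 1) + \<kappa> * g 0)"
proof -
  consider "i = 0" | "i = 1" | "i \<ge> 2" by linarith
  then show ?thesis
    by cases (auto simp: queue_jumps_def queue_rate_def algebra_simps)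
qed

lemma queue_semigroup:
  assumes "lam > 0" "\<mu> > 0" "\<kappa> > 0" "transition_function (queue_rate r lam \<mu> \<kappa>) P"
  shows "jump_semigroup (queue_rate r lam \<mu> \<kappa>) P queue_jumps (lam + real r * \<mu> + \<kappa>)"
proof
  show "(\<Sum>j\<in>queue_jumps i. queue_rate r lam \<mu> \<kappa> i j) \<le> lam + real r * \<mu> + \<kappa>" for i
    using sum_queue_rate[where r = r and lam = lam and \<mu> = \<mu> and \<kappa> = \<kappa> and i = i and g = "\<lambda>_. 1"] assms
    by (auto intro!: mult_right_mono)
qed (use assms in \<open>auto simp: queue_jumps_def queue_rate_def split: if_splits\<close>)

text \<open>Flow balance across the cut between \<open>n\<close> and \<open>Suc n\<close>: the mean of the generator applied to
  the indicator of \<open>{Suc n..}\<close> vanishes.\<close>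

lemma queue_cut_balance:
  assumes "lam > 0" "\<mu> > 0" "\<kappa> > 0"
    and P: "transition_function (queue_rate r lam \<mu> \<kappa>) P" "stationary_distribution P \<pi>"
  shows "lam * pmf \<pi> n = real (min (Suc n) r) * \<mu> * pmf \<pi> (Suc n) + \<kappa> * measure_pmf.prob \<pi> {Suc n..}"
proof -
  interpret jump_semigroup "queue_rate r lam \<mu> \<kappa>" P queue_jumps "lam + real r * \<mu> + \<kappa>"
    using assms by (intro queue_semigroup)
  \<comment> \<open>Only an arrival at \<open>n\<close> crosses the cut upwards; a service crosses
    it downwards only from \<open>Suc n\<close>, a resetting from every state above the cut.\<close>
  have gen: "generator (indicator {Suc n..}) i = lam * indicator {n} i -
      real (min (Suc n) r) * \<mu> * indicator {Suc n} i - \<kappa> * indicator {Suc n..} i" for i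
    unfolding generator_def sum_queue_rate
    by (auto simp: indicator_def)
  have int: "integrable \<pi> (\<lambda>i. c * indicat_real A i)" for c A
    by (intro integrable_mult_right integrable_bounded_pmf[where B = 1]) (simp add: indicator_def)
  have "measure_pmf.expectation \<pi> (generator (indicator {Suc n..})) = 0"
    by (rule stationary_generator[OF P(2), where B = 1]) (auto simp: indicator_def)
  moreover have "measure_pmf.expectation \<pi> (\<lambda>i. a * indicat_real A i - b * indicat_real B i - c * indicat_real D i) =
      a * measure_pmf.prob \<pi> A - b * measure_pmf.prob \<pi> B - c * measure_pmf.prob \<pi> D" for a b c A B D
    using Bochner_Integration.integral_diff[OF Bochner_Integration.integrable_diff[OF int int] int, of a A b B c D]
      Bochner_Integration.integral_diff[OF int int, of a A b B]
    by simp
  ultimately show ?thesis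
    unfolding gen by (simp add: measure_pmf_single)
qed

text \<open>Written with the tails \<open>G\<close>, cut balance is a recursion with characteristic
  roots \<alpha> and \<beta>. Since \<open>G\<close> is bounded it is geometric with ratio \<alpha>,
  and so are its differences, the point masses.\<close>

lemma stationary_geometric_tail:
  fixes r :: nat and lam \<mu> \<kappa> \<theta> \<gamma> \<alpha> :: real
  assumes r: "r \<ge> 1" and pos: "lam > 0" "\<mu> > 0" "\<kappa> > 0"
    and P: "transition_function (queue_rate r lam \<mu> \<kappa>) P" "stationary_distribution P \<pi>"
    and roots: "1 < \<beta>" "real r * (\<alpha> + \<beta>) = real r + lam / \<mu> + \<kappa> / \<mu>" "real r * (\<alpha> * \<beta>) = lam / \<mu>"
    and n: "n \<ge> r"
  shows "pmf \<pi> n = \<alpha> ^ (n - r + 1) * pmf \<pi> (r - 1)"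
proof -
  define G where "G n = measure_pmf.prob \<pi> {n..}" for n
  have diff: "pmf \<pi> n = G n - G (Suc n)" for n
  proof -
    have "{n..} = {n} \<union> {Suc n..}" by auto
    then have "G n = measure_pmf.prob \<pi> {n} + G (Suc n)"
      unfolding G_def by (simp only:) (rule measure_pmf.finite_measure_Union; auto)
    then show ?thesis by (simp add: measure_pmf_single)
  qed
  \<comment> \<open>The recursion starts at \<open>r - 1\<close>: all \<open>r\<close> servers are
    busy in state \<open>r\<close>, just above that cut.\<close>
  have rec: "G (n + 2) = (\<alpha> + \<beta>) * G (n + 1) - \<alpha> * \<beta> * G n" if "n \<ge> r - 1" for n
  proof -
    have "min (Suc n) r = r" using that r by linarith
    then have "lam * (G n - G (Suc n)) = real r * \<mu> * (G (Suc n) - G (Suc (Suc n))) + \<kappa> * G (Suc n)"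
      using queue_cut_balance[OF pos P, of n] by (simp add: diff G_def[symmetric])
    then have "lam / \<mu> * (G n - G (Suc n)) = real r * (G (Suc n) - G (Suc (Suc n))) + \<kappa> / \<mu> * G (Suc n)"
      using pos by (simp add: field_simps)
    moreover have "real r * ((\<alpha> + \<beta>) * G (n + 1) - \<alpha> * \<beta> * G n) =
        (real r * (\<alpha> + \<beta>)) * G (n + 1) - (real r * (\<alpha> * \<beta>)) * G n"
      by (simp add: algebra_simps)
    ultimately have "real r * G (n + 2) = real r * ((\<alpha> + \<beta>) * G (n + 1) - \<alpha> * \<beta> * G n)"
      unfolding roots by (simp add: algebra_simps)
    then show ?thesis using r by simp
  qed
  have "\<bar>G n\<bar> \<le> 1" for n by (simp add: G_def)
  from geometric_recursion[of "r - 1" G \<alpha> \<beta>, OF rec roots(1) this]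
  have G: "G (r - 1 + k) = \<alpha> ^ k * G (r - 1)" for k .
  have "pmf \<pi> (r - 1 + k) = \<alpha> ^ k * pmf \<pi> (r - 1)" for k
    using G[of k] G[of "Suc k"] G[of 1] by (simp add: diff algebra_simps)
  from this[of "n - r + 1"] show ?thesis using r n by simp
qed

section \<open>The tagged customer\<close>

instance tagged_state :: countable
  by countable_datatype

text \<open>The condition \<open>m \<ge> 1\<close> keeps \<open>Serving 0\<close> from being its own
  target under truncated subtraction.\<close>

fun tagged_jumps :: "nat \<Rightarrow> tagged_state \<Rightarrow> tagged_state set" where
  "tagged_jumps r (Waiting a b) =
     {Waiting a (b + 1), if a \<le> r then Serving (a - 1 + b) else Waiting (a - 1) b, Cleared}"
| "tagged_jumps r (Serving m) =
     {Serving (m + 1), Completed, Cleared} \<union> (if m \<ge> 1 then {Serving (m - 1)} else {})"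
| "tagged_jumps r Completed = {}"
| "tagged_jumps r Cleared = {}"

lemma sum_tagged_rate_Waiting:
  "(\<Sum>s\<in>tagged_jumps r (Waiting a b). tagged_rate r lam \<mu> \<kappa> (Waiting a b) s * g s) =
    lam * g (Waiting a (b + 1)) +
    real (min a r) * \<mu> * g (if a \<le> r then Serving (a - 1 + b) else Waiting (a - 1) b) + \<kappa> * g Cleared"
  by auto

lemma sum_tagged_rate_Serving:
  "(\<Sum>s\<in>tagged_jumps r (Serving m). tagged_rate r lam \<mu> \<kappa> (Serving m) s * g s) =
    lam * g (Serving (m + 1)) + \<mu> * g Completed +
    (if m \<ge> 1 then real (min (m + 1) r - 1) * \<mu> * g (Serving (m - 1)) else 0) + \<kappa> * g Cleared"
  by auto

lemma tagged_semigroup: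
  assumes "r \<ge> 1" "lam > 0" "\<mu> > 0" "\<kappa> > 0" "transition_function (tagged_rate r lam \<mu> \<kappa>) T"
  shows "jump_semigroup (tagged_rate r lam \<mu> \<kappa>) T (tagged_jumps r) (lam + real r * \<mu> + \<kappa>)"
proof
  show "(\<Sum>j\<in>tagged_jumps r i. tagged_rate r lam \<mu> \<kappa> i j) \<le> lam + real r * \<mu> + \<kappa>" for i
  proof (cases i)
    case (Waiting a b)
    then show ?thesis
      using sum_tagged_rate_Waiting[of r lam \<mu> \<kappa> a b "\<lambda>_. 1"] assms
      by (simp del: tagged_jumps.simps tagged_rate.simps)
  next
    case (Serving m)
    \<comment> \<open>The tagged customer holds one server, so at most \<open>r - 1\<close> others
      are busy and the total service rate is at most \<open>real r * \<mu>\<close>.\<close>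
    have "(real (min (Suc m) r) - 1) * \<mu> \<le> (real r - 1) * \<mu>"
      using assms by (intro mult_right_mono) auto
    then have "\<mu> + (real (min (Suc m) r) - 1) * \<mu> \<le> real r * \<mu>"
      by (simp add: algebra_simps)
    moreover have "\<mu> \<le> real r * \<mu>" using assms by simp
    ultimately show ?thesis
      using sum_tagged_rate_Serving[of r lam \<mu> \<kappa> m "\<lambda>_. 1"] Serving assms
      by (simp del: tagged_jumps.simps tagged_rate.simps split: if_splits)
  qed (use assms in auto)
  show "finite (tagged_jumps r i)" for i by (cases i) auto
  show "i \<notin> tagged_jumps r i" for i by (cases i) auto
  show "tagged_rate r lam \<mu> \<kappa> i j = 0" if "j \<noteq> i" "j \<notin> tagged_jumps r i" for i j
    using that by (cases i) (auto split: if_splits)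
qed (use assms in auto)

text \<open>The exponent is also right in the unreachable
  states \<open>Waiting a b\<close> with \<open>a < r\<close>, where truncated subtraction makes it \<open>1\<close>.\<close>

fun success :: "nat \<Rightarrow> real \<Rightarrow> real \<Rightarrow> tagged_state \<Rightarrow> real" where
  "success r \<mu> \<kappa> (Waiting a b) =
     (real (min a r) * \<mu> / (real (min a r) * \<mu> + \<kappa>)) ^ (a - r + 1) * (\<mu> / (\<mu> + \<kappa>))"
| "success r \<mu> \<kappa> (Serving m) = \<mu> / (\<mu> + \<kappa>)"
| "success r \<mu> \<kappa> Completed = 1"
| "success r \<mu> \<kappa> Cleared = 0"

lemma success_bounds:
  assumes "\<mu> > 0" "\<kappa> > 0"
  shows "0 \<le> success r \<mu> \<kappa> s \<and> success r \<mu> \<kappa> s \<le> 1"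
proof (cases s)
  case (Waiting a b)
  have "0 \<le> real (min a r) * \<mu> / (real (min a r) * \<mu> + \<kappa>)"
    "real (min a r) * \<mu> / (real (min a r) * \<mu> + \<kappa>) \<le> 1"
    using assms by (auto simp: divide_le_eq_1 add_nonneg_pos intro!: divide_nonneg_pos)
  then show ?thesis
    unfolding Waiting success.simps using assms by (intro conjI mult_nonneg_nonneg mult_le_one power_le_one) auto
qed (use assms in auto)

section \<open>Absorption probabilities of the tagged customer\<close>

context
  fixes r :: nat and lam \<mu> \<kappa> :: real and T :: "real \<Rightarrow> tagged_state \<Rightarrow> tagged_state pmf"
  assumes r: "r \<ge> 1" and pos: "lam > 0" "\<mu> > 0" "\<kappa> > 0"
    and T: "transition_function (tagged_rate r lam \<mu> \<kappa>) T"
begin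

interpretation jump_semigroup "tagged_rate r lam \<mu> \<kappa>" T "tagged_jumps r" "lam + real r * \<mu> + \<kappa>"
  by (intro tagged_semigroup r pos T)

text \<open>The exit rate is an empty sum, so \<open>leave_le\<close> gives leaving probability
  0.\<close>

lemma Completed_absorbing:
  assumes "t \<ge> 0"
  shows "pmf (T t Completed) Completed = 1"
  using leave_le[OF assms, of Completed] pmf_le_1[of "T t Completed" Completed] by simp

text \<open>\<open>success\<close> ignores later arrivals, so the arrival terms cancel. While
  waiting, it is \<open>m / (m + \<kappa>)\<close>, the chance that a service ahead precedes a
  resetting, times its value after that service. In service it is constant and balances \<mu>
  against \<kappa>.\<close>

lemma success_harmonic: "generator (success r \<mu> \<kappa>) s = 0"
proof (cases s)
  case (Waiting a b)
  define m where "m = real (min a r) * \<mu>"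
  have m: "m \<ge> 0" "m + \<kappa> \<noteq> 0" using pos by (auto simp: m_def add_nonneg_pos less_imp_neq[symmetric])
  define x where "x = success r \<mu> \<kappa> (if a \<le> r then Serving (a - 1 + b) else Waiting (a - 1) b)"
  have "success r \<mu> \<kappa> (Waiting a b) = m / (m + \<kappa>) * x"
  proof (cases "a \<le> r")
    \<comment> \<open>With more than \<open>r\<close> customers ahead, a service lowers the exponent
      by one and leaves all \<open>r\<close> servers busy.\<close>
    case False
    then have "min a r = r" "min (a - 1) r = r" "a - r + 1 = Suc (a - 1 - r + 1)" by auto
    then have "success r \<mu> \<kappa> (Waiting a b) = (m / (m + \<kappa>)) ^ Suc (a - 1 - r + 1) * (\<mu> / (\<mu> + \<kappa>))"
      "x = (m / (m + \<kappa>)) ^ (a - 1 - r + 1) * (\<mu> / (\<mu> + \<kappa>))"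
      using False by (simp_all add: m_def x_def)
    then show ?thesis by (simp only: power_Suc mult.assoc)
  qed (simp add: m_def x_def)
  then have "(m + \<kappa>) * success r \<mu> \<kappa> (Waiting a b) = m * x"
    using m by simp
  moreover have "success r \<mu> \<kappa> (Waiting a (b + 1)) = success r \<mu> \<kappa> (Waiting a b)"
    by simp
  ultimately show ?thesis
    unfolding generator_def Waiting sum_tagged_rate_Waiting m_def[symmetric] x_def[symmetric]
    by (simp add: algebra_simps del: success.simps(1))
next
  case (Serving k)
  define c where "c = \<mu> / (\<mu> + \<kappa>)"
  have "(\<mu> + \<kappa>) * c = \<mu>" using pos by (simp add: c_def)
  then show ?thesis
    unfolding generator_def Serving sum_tagged_rate_Serving success.simps c_def[symmetric]
    by (simp add: algebra_simps)
qed (simp_all add: generator_def)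

text \<open>The generator maps the indicator of the transient states to -\<kappa> on waiting states,
  to -(\<kappa> + \<mu>) on serving states and to 0 on the absorbing ones.\<close>

lemma transient_decay:
  assumes "t \<ge> 0"
  shows "measure_pmf.prob (T t s) (- {Completed, Cleared}) \<le> exp (- \<kappa> * t)"
proof -
  define f :: "tagged_state \<Rightarrow> real" where "f = indicator (- {Completed, Cleared})"
  have "measure_pmf.expectation (T t s) f \<le> exp (- \<kappa> * t) * f s"
  proof (rule expectation_le_exp[where B = 1])
    show "generator f s \<le> - \<kappa> * f s" for s
    proof (cases s)
      case (Waiting a b)
      then show ?thesis
        unfolding generator_def Waiting sum_tagged_rate_Waiting by (auto simp: f_def)
    next
      case (Serving m)
      then show ?thesis
        unfolding generator_def Serving sum_tagged_rate_Serving using pos by (auto simp: f_def)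
    qed (simp_all add: generator_def f_def)
  qed (use assms in \<open>auto simp: f_def indicator_def\<close>)
  also have "\<dots> \<le> exp (- \<kappa> * t) * 1"
    by (intro mult_left_mono) (auto simp: f_def indicator_def)
  finally show ?thesis by (simp add: f_def)
qed

text \<open>On the two absorbing states \<open>success\<close> is the indicator of
  \<open>Completed\<close>. By harmonicity the error at time \<open>n\<close> is therefore at most
  the probability of being transient.\<close>

lemma completion_limit: "(\<lambda>n. pmf (T (real n) s) Completed) \<longlonglongrightarrow> success r \<mu> \<kappa> s"
proof -
  let ?h = "success r \<mu> \<kappa>"
  note bounds = success_bounds[OF pos(2,3), of r]
  have "\<bar>pmf (T (real n) s) Completed - ?h s\<bar> \<le> exp (- \<kappa> * real n)" for n
  proof -
    have "?h s = measure_pmf.expectation (T (real n) s) ?h"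
      using bounds by (intro expectation_harmonic[symmetric, where B = 1] success_harmonic) auto
    also have "\<dots> = measure_pmf.expectation (T (real n) s)
        (\<lambda>x. indicator {Completed} x + ?h x * indicator (- {Completed, Cleared}) x)"
    proof (rule Bochner_Integration.integral_cong)
      show "?h x = indicator {Completed} x + ?h x * indicator (- {Completed, Cleared}) x" for x
        by (cases x) auto
    qed simp
    also have "\<dots> = pmf (T (real n) s) Completed +
        measure_pmf.expectation (T (real n) s) (\<lambda>x. ?h x * indicator (- {Completed, Cleared}) x)"
      using bounds
      by (subst Bochner_Integration.integral_add)
         (auto simp: measure_pmf_single indicator_def intro!: integrable_bounded_pmf[where B = 1])
    finally have eq: "?h s - pmf (T (real n) s) Completed =
        measure_pmf.expectation (T (real n) s) (\<lambda>x. ?h x * indicator (- {Completed, Cleared}) x)" by simp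
    have "0 \<le> \<dots>" using bounds by (intro integral_nonneg_AE AE_I2) auto
    moreover have "measure_pmf.expectation (T (real n) s) (\<lambda>x. ?h x * indicator (- {Completed, Cleared}) x)
        \<le> measure_pmf.expectation (T (real n) s) (indicator (- {Completed, Cleared}))"
      using bounds by (intro integral_mono integrable_bounded_pmf[where B = 1]) (auto simp: indicator_def)
    ultimately show ?thesis
      using transient_decay[of "real n" s] eq by simp
  qed
  then have "\<forall>\<^sub>F n in sequentially. norm (pmf (T (real n) s) Completed - ?h s) \<le> exp (- \<kappa> * real n)"
    unfolding real_norm_def by (intro always_eventually allI)
  moreover have "(\<lambda>n. exp (- \<kappa> * real n)) \<longlonglongrightarrow> 0"
    using pos by real_asymp
  ultimately have "(\<lambda>n. pmf (T (real n) s) Completed - ?h s) \<longlonglongrightarrow> 0"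
    by (rule Lim_null_comparison)
  then show ?thesis by (rule LIM_zero_cancel)
qed

text \<open>Both sides are limits of the probability of \<open>Completed\<close> at time
  \<open>n\<close>: one by absorption, the other by averaging \<open>completion_limit\<close> over
  the initial state.\<close>

lemma completion_probability_eq:
  assumes "markov_chain M X p T"
  shows "completion_probability M X = measure_pmf.expectation p (success r \<mu> \<kappa>)"
proof (rule LIMSEQ_unique)
  show "(\<lambda>n. pmf (bind_pmf p (T (real n))) Completed) \<longlonglongrightarrow> completion_probability M X"
    unfolding completion_probability_def
    by (rule absorption_limit[OF assms Completed_absorbing P_0])
  show "(\<lambda>n. pmf (bind_pmf p (T (real n))) Completed) \<longlonglongrightarrow> measure_pmf.expectation p (success r \<mu> \<kappa>)"
    unfolding pmf_bind using completion_limit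
    by (intro integral_dominated_convergence[where w = "\<lambda>_. 1"]) (auto simp: pmf_le_1)
qed

end


text \<open>The closed forms carry the factor of \<open>weighted_tail_eq\<close>, with numerator
  \<open>(1 - \<alpha>) * real r\<close>. By \<open>weighted_tail_iff\<close>, for a positive tail
  the numerator \<open>(1 - \<alpha>) * \<gamma>\<close> would force \<gamma> = r.\<close>

theorem mainTheorem10:
  fixes r :: nat
    and lam \<mu> \<kappa> \<theta> \<gamma> \<alpha> :: real
    and P :: "real \<Rightarrow> nat \<Rightarrow> nat pmf"
    and \<pi> :: "nat pmf"
    and T :: "real \<Rightarrow> tagged_state \<Rightarrow> tagged_state pmf"
    and M :: "'w measure"
    and X :: "real \<Rightarrow> 'w \<Rightarrow> tagged_state"
    and P_delay P_CSBR :: real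
  assumes "r \<ge> 1" and "lam > 0" and "\<mu> > 0" and "\<kappa> > 0"
    and "\<theta> = lam / \<mu>" and "\<gamma> = \<kappa> / \<mu>"
    and "\<alpha> = (real r + \<theta> + \<gamma> - sqrt ((real r + \<theta> + \<gamma>)\<^sup>2 - 4 * \<theta> * real r)) / (2 * real r)"
    and "transition_function (queue_rate r lam \<mu> \<kappa>) P"
    and "stationary_distribution P \<pi>"
    and "P_delay = delay_probability r \<pi>"
    and "transition_function (tagged_rate r lam \<mu> \<kappa>) T"
    and "markov_chain M X (map_pmf (arrival_state r) \<pi>) T"
    and "P_CSBR = completion_probability M X"
  shows "P_CSBR =
           (\<Sum>n<r. pmf \<pi> n * (1 / (1 + \<gamma>))) +
           (\<Sum>\<^sub>\<infinity>n\<in>{r..}. pmf \<pi> n * (real r / (real r + \<gamma>)) ^ (n - r + 1) * (1 / (1 + \<gamma>)))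
       \<and> P_CSBR =
           1 / (1 + \<gamma>) * (1 - P_delay) +
           1 / (1 + \<gamma>) * ((1 - \<alpha>) * real r / ((1 - \<alpha>) * real r + \<gamma>)) * P_delay
       \<and> P_CSBR =
           1 / (1 + \<gamma>) - \<gamma> / ((1 + \<gamma>) * ((1 - \<alpha>) * real r + \<gamma>)) * P_delay"
proof -
  note r = assms(1) and pos = assms(2-4)
  have \<gamma>: "\<gamma> > 0" and \<theta>: "\<theta> > 0" using assms by auto
  \<comment> \<open>\<open>y\<close> is the probability that, with all servers busy, a service
    completion comes before a resetting; \<open>w n\<close> is \<open>success\<close> at the arrival
    state, written with \<gamma>.\<close>
  define y where "y = real r / (real r + \<gamma>)"
  define w where "w n = (if n < r then 1 else y ^ (n - r + 1)) * (1 / (1 + \<gamma>))" for n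
  have y: "0 \<le> y" "y \<le> 1" using \<gamma> by (auto simp: y_def)
  have success_arrival: "success r \<mu> \<kappa> (arrival_state r n) = w n" for n
  proof -
    have "real r * \<mu> / (real r * \<mu> + \<kappa>) = y" "\<mu> / (\<mu> + \<kappa>) = 1 / (1 + \<gamma>)"
      using pos r unfolding y_def assms(6) by (simp_all add: field_simps)
    then show ?thesis by (simp add: arrival_state_def w_def)
  qed
  have "P_CSBR = measure_pmf.expectation \<pi> w"
    using completion_probability_eq[OF r pos assms(11,12)]
    by (simp add: assms(13) success_arrival)
  moreover have w: "\<bar>w n\<bar> \<le> 1" for n
  proof -
    have "0 \<le> y ^ (n - r + 1)" "y ^ (n - r + 1) \<le> 1"
      using y by (auto intro!: zero_le_power power_le_one simp del: power_Suc)
    then show ?thesis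
      using \<gamma> unfolding w_def abs_mult by (intro mult_le_one) auto
  qed
  ultimately have sum: "((\<lambda>n. pmf \<pi> n * w n) has_sum P_CSBR) UNIV"
    using pmf_expectation_has_sum[of w 1 \<pi>] by simp
  then have "(\<lambda>n. pmf \<pi> n * w n) summable_on {r..}"
    by (meson has_sum_imp_summable subset_UNIV summable_on_subset_banach)
  then have "((\<lambda>n. pmf \<pi> n * w n) has_sum ((\<Sum>n<r. pmf \<pi> n * w n) + (\<Sum>\<^sub>\<infinity>n\<in>{r..}. pmf \<pi> n * w n)))
      ({..<r} \<union> {r..})"
    by (intro has_sum_Un_disjoint has_sum_finite has_sum_infsum) auto
  moreover have "{..<r} \<union> {r..} = (UNIV :: nat set)" by auto
  ultimately have "P_CSBR = (\<Sum>n<r. pmf \<pi> n * w n) + (\<Sum>\<^sub>\<infinity>n\<in>{r..}. pmf \<pi> n * w n)"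
    using sum by (metis has_sum_unique)
  also have "(\<Sum>n<r. pmf \<pi> n * w n) = (\<Sum>n<r. pmf \<pi> n * (1 / (1 + \<gamma>)))"
    by (simp add: w_def)
  also have "(\<Sum>\<^sub>\<infinity>n\<in>{r..}. pmf \<pi> n * w n) =
      (\<Sum>\<^sub>\<infinity>n\<in>{r..}. pmf \<pi> n * y ^ (n - r + 1) * (1 / (1 + \<gamma>)))"
    by (intro infsum_cong) (simp add: w_def)
  finally have first: "P_CSBR = (\<Sum>n<r. pmf \<pi> n * (1 / (1 + \<gamma>))) +
      (\<Sum>\<^sub>\<infinity>n\<in>{r..}. pmf \<pi> n * y ^ (n - r + 1) * (1 / (1 + \<gamma>)))" .
  obtain \<beta> where roots: "0 < \<alpha>" "\<alpha> < 1" "1 < \<beta>" "real r * (\<alpha> + \<beta>) = real r + \<theta> + \<gamma>"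
    "real r * (\<alpha> * \<beta>) = \<theta>"
    using alpha_roots[OF _ \<theta> \<gamma> assms(7)] r by auto
  have tail: "pmf \<pi> n = \<alpha> ^ (n - r + 1) * pmf \<pi> (r - 1)" if "n \<ge> r" for n
    using stationary_geometric_tail[OF r pos assms(8,9) roots(3) _ _ that] roots(4,5) assms(5,6) by simp
  have weighted: "(\<Sum>\<^sub>\<infinity>n\<in>{r..}. pmf \<pi> n * y ^ (n - r + 1)) =
      (1 - \<alpha>) * real r / ((1 - \<alpha>) * real r + \<gamma>) * P_delay"
  proof (cases "pmf \<pi> (r - 1) = 0")
    \<comment> \<open>\<open>weighted_tail_eq\<close> asks for a positive constant. If the mass at
      \<open>r - 1\<close> is zero, the geometric tail makes both sums zero.\<close>
    case True
    then have zero: "pmf \<pi> n = 0" if "n \<in> {r..}" for n using tail that by simp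
    have "(\<Sum>\<^sub>\<infinity>n\<in>{r..}. pmf \<pi> n * y ^ (n - r + 1)) = 0" "(\<Sum>\<^sub>\<infinity>n\<in>{r..}. pmf \<pi> n) = 0"
      using zero by (auto intro!: infsum_0)
    then show ?thesis
      by (simp only: assms(10) delay_probability_def mult_zero_right)
  next
    case False
    then have "pmf \<pi> (r - 1) > 0" by (simp add: pmf_positive_iff set_pmf_iff)
    from weighted_tail_eq[OF r \<gamma> roots(1,2) this tail] show ?thesis
      by (simp add: assms(10) delay_probability_def y_def)
  qed
  have "P_delay = measure_pmf.prob \<pi> {r..}"
    unfolding assms(10) delay_probability_def measure_pmf_conv_infsetsum
    by (metis abs_summable_equivalent infsetsum_infsum pmf_abs_summable)
  moreover have "UNIV - {..<r} = {r..}" by auto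
  ultimately have "P_delay = 1 - measure_pmf.prob \<pi> {..<r}"
    using measure_pmf.prob_compl[of "{..<r}" \<pi>] by simp
  then have "(\<Sum>n<r. pmf \<pi> n) = 1 - P_delay"
    by (simp add: measure_measure_pmf_finite)
  then have second: "P_CSBR = 1 / (1 + \<gamma>) * (1 - P_delay) +
      1 / (1 + \<gamma>) * ((1 - \<alpha>) * real r / ((1 - \<alpha>) * real r + \<gamma>)) * P_delay"
    unfolding first sum_distrib_right[symmetric] infsum_cmult_left' weighted by simp
  \<comment> \<open>Writing the factor as 1 minus a fraction cancels the two terms in
    \<open>P_delay\<close> that carry only \<open>1 / (1 + \<gamma>)\<close>.\<close>
  have "(1 - \<alpha>) * real r + \<gamma> > 0" using roots \<gamma> by (simp add: add_nonneg_pos)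
  then have "(1 - \<alpha>) * real r / ((1 - \<alpha>) * real r + \<gamma>) = 1 - \<gamma> / ((1 - \<alpha>) * real r + \<gamma>)"
    by (simp add: field_simps)
  then have "P_CSBR = 1 / (1 + \<gamma>) * (1 - P_delay) +
      1 / (1 + \<gamma>) * (1 - \<gamma> / ((1 - \<alpha>) * real r + \<gamma>)) * P_delay"
    using second by simp
  also have "\<dots> = 1 / (1 + \<gamma>) - 1 / (1 + \<gamma>) * (\<gamma> / ((1 - \<alpha>) * real r + \<gamma>)) * P_delay"
  proof -
    have "c * (1 - x) + c * (1 - d) * x = c - c * d * x" for c d x :: real
      by (simp add: algebra_simps)
    then show ?thesis .
  qed
  also have "\<dots> = 1 / (1 + \<gamma>) - \<gamma> / ((1 + \<gamma>) * ((1 - \<alpha>) * real r + \<gamma>)) * P_delay"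
    by simp
  finally show ?thesis using first second by (simp add: y_def)
qed

end
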